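(* Let $(V_i,v_i,\varphi^{(i)})_{i\in I}$ be a fusion frame system for $\mathcal{H}$ and let $v\varphi=(v_i\varphi_{ij})_{i\in I,j\in J_i}$ be its corresponding global frame. Then $$D_V=D_{v\varphi}\bigoplus_{i\in I}(C_{\varphi^{(i)}}S_{\varphi^{(i)}}^{-1}),$$ $$C_V=\Big(\bigoplus_{i\in I}(S_{\varphi^{(i)}}^{-1}D_{\varphi^{(i)}})\Big)C_{v\varphi},$$ $$S_V=D_{v\varphi}\Big(\bigoplus_{i\in I}(C_{\varphi^{(i)}}S_{\varphi^{(i)}}^{-2}D_{\varphi^{(i)}})\Big)C_{v\varphi}.$$
   Context: $\mathcal{H}$ is a separable Hilbert space; $\pi_U$ denotes the orthogonal projection onto a closed subspace $U$. A frame for a Hilbert space $K$ is a countable family $\psi=(\psi_j)_{j\in J}$ in $K$ with constants $0<A\le B<\infty$ (frame bounds) such that $A\|f\|^2\le\sum_j|\langle f,\psi_j\rangle|^2\le B\|f\|^2$ for all $f\in K$. Its associated bounded operators are the synthesis operator $D_\psi:\ell^2(J)\to K$, $D_\psi(c_j)_j=\sum_jc_j\psi_j$; the analysis operator $C_\psi:K\to\ell^2(J)$, $C_\psi f=(\langle f,\psi_j\rangle)_j$; the frame operator $S_\psi:K\to K$, $S_\psi f=\sum_j\langle f,\psi_j\rangle\psi_j$, which is invertible. For Hilbert spaces $V_i$ ($i\in I$), the Hilbert direct sum is $(\sum_{i\in I}\oplus V_i)_{\ell^2}=\{(f_i)_{i\in I}:f_i\in V_i,\ \sum_i\|f_i\|^2<\infty\}$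 with inner product $\sum_i\langle f_i,g_i\rangle_{V_i}$. For bounded operators $\mathcal{O}_i:V_i\to W_i$ with $\sup_i\|\mathcal{O}_i\|<\infty$, $\bigoplus_{i\in I}\mathcal{O}_i$ is the bounded operator $(\sum_i\oplus V_i)_{\ell^2}\to(\sum_i\oplus W_i)_{\ell^2}$, $(f_i)_i\mapsto(\mathcal{O}_if_i)_i$. A fusion frame for $\mathcal{H}$ is a countable family $V=(V_i,v_i)_{i\in I}$ of closed subspaces with weights $v_i>0$ for which there are constants $0<A_V\le B_V<\infty$ with $A_V\|f\|^2\le\sum_{i} v_i^2\|\pi_{V_i}f\|^2\le B_V\|f\|^2$ for all $f\in\mathcal{H}$. Its associated bounded operators are $D_V:(\sum_i\oplus V_i)_{\ell^2}\to\mathcal{H}$, $D_V(f_i)_i=\sum_iv_if_i$; $C_V:\mathcal{H}\to(\sum_i\oplus V_i)_{\ell^2}$, $C_Vf=(v_i\pi_{V_i}f)_i$; $S_V:\mathcal{H}\to\mathcal{H}$, $S_Vf=\sum_iv_i^2\pi_{V_i}f$. A fusion frame system $(V_i,v_i,\varphi^{(i)})_{i\in I}$ for $\mathcal{H}$ consists of a fusion frame $V=(V_i,v_i)_{i\in I}$ for $\mathcal{H}$ and, for every $i\in I$, a frame $\varphi^{(i)}=(\varphi_{ij})_{j\in J_i}$ for $V_i$, such that these local frames have common frame bounds $0<A\le B<\infty$. Its global frame is $v\varphi=(v_i\varphi_{ij})_{i\in I,j\in J_i}$, which is a frame for $\mathcal{H}$ with coefficient space $\ell^2(\biguplus_{i\in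 I}J_i)$ of square-summable families $(c_{ij})_{i\in I,j\in J_i}$. This space is identified with $(\sum_{i\in I}\oplus\ell^2(J_i))_{\ell^2}$ via the isometric isomorphism $(c_{ij})_{i,j}\mapsto((c_{ij})_{j\in J_i})_{i\in I}$. *)

theory Defs
  imports "HOL-Analysis.Analysis"
begin

(* By the Gelfand-Mazur theorem a real_normed_field is isomorphic to the reals or to the
   complex numbers; the class makes the conjugation available uniformly in both cases. *)
class rc_field = real_normed_field +
  fixes conj :: "'a \<Rightarrow> 'a"
  assumes conj_add: "conj (x + y) = conj x + conj y"
    and mult_conj: "x * conj x = (norm x)\<^sup>2 *\<^sub>R 1"

instantiation real :: rc_field
begin
definition conj_real :: "real \<Rightarrow> real" where "conj_real x = x"
instance by standard (auto simp: conj_real_def power2_eq_square)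
end

instantiation complex :: rc_field
begin
definition conj_complex :: "complex \<Rightarrow> complex" where "conj_complex = cnj"
instance
proof
  fix x y :: complex
  show "conj (x + y) = conj x + conj y" by (simp add: conj_complex_def)
  show "x * conj x = (norm x)\<^sup>2 *\<^sub>R 1"
    unfolding conj_complex_def of_real_def [symmetric] by (rule complex_norm_square [symmetric])
qed
end

locale separable_hilbert_space = vector_space smul
  for smul :: "'k::rc_field \<Rightarrow> 'v::banach \<Rightarrow> 'v" +
  fixes ip :: "'v \<Rightarrow> 'v \<Rightarrow> 'k"
  assumes scale_of_real: "smul (of_real r) x = r *\<^sub>R x"
    and ip_add_left: "ip (x + y) z = ip x z + ip y z"
    and ip_scale_left: "ip (smul a x) y = a * ip x y"
    and ip_commute: "ip y x = conj (ip x y)"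
    and ip_norm: "ip x x = of_real ((norm x)\<^sup>2)"
    and separable: "\<exists>D::'v set. countable D \<and> closure D = UNIV"

lemma separable_UNIV:
  "\<exists>D::'a::{metric_space, second_countable_topology} set. countable D \<and> closure D = UNIV"
proof -
  obtain D :: "'a set" where "countable D" "UNIV \<subseteq> closure D"
    using separable[of "UNIV :: 'a set"] by metis
  then show ?thesis by (intro exI[of _ D]) (simp add: top.extremum_unique)
qed

lemma separable_hilbert_space_real:
  "separable_hilbert_space (*\<^sub>R) ((\<bullet>) :: 'a::{real_inner, banach, second_countable_topology} \<Rightarrow> 'a \<Rightarrow> real)"
proof
  show "\<exists>D::'a set. countable D \<and> closure D = UNIV" by (rule separable_UNIV)
  show "y \<bullet> x = conj (x \<bullet> y)" for x y :: 'a
    by (simp add: conj_real_def inner_commute)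
qed (simp_all add: scaleR_add_right scaleR_add_left inner_add_left power2_norm_eq_inner)

lemma separable_hilbert_space_complex:
  "separable_hilbert_space (*) (\<lambda>x y :: complex. x * cnj y)"
proof
  show "\<exists>D::complex set. countable D \<and> closure D = UNIV" by (rule separable_UNIV)
  show "x * cnj x = of_real ((norm x)\<^sup>2)" for x :: complex
    by (rule complex_norm_square [symmetric])
qed (simp_all add: conj_complex_def distrib_left distrib_right scaleR_conv_of_real mult.assoc)

definition orth_proj :: "('v \<Rightarrow> 'v \<Rightarrow> 'k::rc_field) \<Rightarrow> 'v::banach set \<Rightarrow> 'v \<Rightarrow> 'v" where
  "orth_proj ip U f = (THE p. p \<in> U \<and> (\<forall>u\<in>U. ip (f - p) u = 0))"


(* Spaces of families indexed by a set consist of extensional functions, and every operator is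
   an extensional function on its domain (undefined elsewhere).  Hence an identity between
   composites can only be derived by showing that intermediate values lie in the domain of the
   operator applied next. *)

definition l2 :: "'j set \<Rightarrow> ('j \<Rightarrow> 'k::real_normed_vector) set" where
  "l2 J = {c \<in> extensional J. (\<lambda>j. (norm (c j))\<^sup>2) summable_on J}"

definition l2_norm :: "'j set \<Rightarrow> ('j \<Rightarrow> 'k::real_normed_vector) \<Rightarrow> real" where
  "l2_norm J c = sqrt (\<Sum>\<^sub>\<infinity>j\<in>J. (norm (c j))\<^sup>2)"

(* nrm i is the norm of the Hilbert space X i; it is a parameter because the summands are
   both subspaces of a type and sequence spaces l2 (J i). *)
definition hilbert_sum ::
    "'i set \<Rightarrow> ('i \<Rightarrow> 'x set) \<Rightarrow> ('i \<Rightarrow> 'x \<Rightarrow> real) \<Rightarrow> ('i \<Rightarrow> 'x) set" where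
  "hilbert_sum I X nrm = {f \<in> (\<Pi>\<^sub>E i\<in>I. X i). (\<lambda>i. (nrm i (f i))\<^sup>2) summable_on I}"

definition direct_sum_op ::
    "'i set \<Rightarrow> ('i \<Rightarrow> 'x set) \<Rightarrow> ('i \<Rightarrow> 'x \<Rightarrow> real) \<Rightarrow> ('i \<Rightarrow> 'x \<Rightarrow> 'y) \<Rightarrow> ('i \<Rightarrow> 'x) \<Rightarrow> 'i \<Rightarrow> 'y" where
  "direct_sum_op I X nrm T = (\<lambda>f \<in> hilbert_sum I X nrm. \<lambda>i\<in>I. T i (f i))"

(* The two directions of the isometric isomorphism between the square-summable families over
   the disjoint union of the J i and the Hilbert direct sum of the spaces l2 (J i). *)
definition l2_split ::
    "'i set \<Rightarrow> ('i \<Rightarrow> 'j set) \<Rightarrow> ('i \<times> 'j \<Rightarrow> 'k::real_normed_vector) \<Rightarrow> 'i \<Rightarrow> 'j \<Rightarrow> 'k" where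
  "l2_split I J = (\<lambda>c \<in> l2 (Sigma I J). \<lambda>i\<in>I. \<lambda>j\<in>J i. c (i, j))"

definition l2_join ::
    "'i set \<Rightarrow> ('i \<Rightarrow> 'j set) \<Rightarrow> ('i \<Rightarrow> 'j \<Rightarrow> 'k::real_normed_vector) \<Rightarrow> 'i \<times> 'j \<Rightarrow> 'k" where
  "l2_join I J = (\<lambda>c \<in> hilbert_sum I (\<lambda>i. l2 (J i)) (\<lambda>i. l2_norm (J i)).
     \<lambda>(i, j) \<in> Sigma I J. c i j)"


(* Frames for a closed subspace K; a frame for the whole space is the case K = UNIV. *)

definition frame_with_bounds ::
    "('v \<Rightarrow> 'v \<Rightarrow> 'k::rc_field) \<Rightarrow> 'v::banach set \<Rightarrow> 'j set \<Rightarrow> ('j \<Rightarrow> 'v) \<Rightarrow> real \<Rightarrow> real \<Rightarrow> bool" where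
  "frame_with_bounds ip K J \<psi> A B \<longleftrightarrow>
     countable J \<and> (\<forall>j\<in>J. \<psi> j \<in> K) \<and> 0 < A \<and> A \<le> B \<and>
     (\<forall>f\<in>K. (\<lambda>j. (norm (ip f (\<psi> j)))\<^sup>2) summable_on J \<and>
        A * (norm f)\<^sup>2 \<le> (\<Sum>\<^sub>\<infinity>j\<in>J. (norm (ip f (\<psi> j)))\<^sup>2) \<and>
        (\<Sum>\<^sub>\<infinity>j\<in>J. (norm (ip f (\<psi> j)))\<^sup>2) \<le> B * (norm f)\<^sup>2)"

definition synthesis ::
    "('k::rc_field \<Rightarrow> 'v::banach \<Rightarrow> 'v) \<Rightarrow> 'j set \<Rightarrow> ('j \<Rightarrow> 'v) \<Rightarrow> ('j \<Rightarrow> 'k) \<Rightarrow> 'v" where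
  "synthesis smul J \<psi> = (\<lambda>c \<in> l2 J. \<Sum>\<^sub>\<infinity>j\<in>J. smul (c j) (\<psi> j))"

definition analysis ::
    "('v \<Rightarrow> 'v \<Rightarrow> 'k::rc_field) \<Rightarrow> 'v::banach set \<Rightarrow> 'j set \<Rightarrow> ('j \<Rightarrow> 'v) \<Rightarrow> 'v \<Rightarrow> 'j \<Rightarrow> 'k" where
  "analysis ip K J \<psi> = (\<lambda>f\<in>K. \<lambda>j\<in>J. ip f (\<psi> j))"

definition frame_op ::
    "('k::rc_field \<Rightarrow> 'v::banach \<Rightarrow> 'v) \<Rightarrow> ('v \<Rightarrow> 'v \<Rightarrow> 'k) \<Rightarrow> 'v set \<Rightarrow> 'j set \<Rightarrow> ('j \<Rightarrow> 'v) \<Rightarrow> 'v \<Rightarrow> 'v" where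
  "frame_op smul ip K J \<psi> = (\<lambda>f\<in>K. \<Sum>\<^sub>\<infinity>j\<in>J. smul (ip f (\<psi> j)) (\<psi> j))"

definition inv_frame_op ::
    "('k::rc_field \<Rightarrow> 'v::banach \<Rightarrow> 'v) \<Rightarrow> ('v \<Rightarrow> 'v \<Rightarrow> 'k) \<Rightarrow> 'v set \<Rightarrow> 'j set \<Rightarrow> ('j \<Rightarrow> 'v) \<Rightarrow> 'v \<Rightarrow> 'v" where
  "inv_frame_op smul ip K J \<psi> = (\<lambda>g\<in>K. inv_into K (frame_op smul ip K J \<psi>) g)"


definition fusion_frame ::
    "('k::rc_field \<Rightarrow> 'v::banach \<Rightarrow> 'v) \<Rightarrow> ('v \<Rightarrow> 'v \<Rightarrow> 'k) \<Rightarrow>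
     'i set \<Rightarrow> ('i \<Rightarrow> 'v set) \<Rightarrow> ('i \<Rightarrow> real) \<Rightarrow> bool" where
  "fusion_frame smul ip I V v \<longleftrightarrow>
     countable I \<and> (\<forall>i\<in>I. module.subspace smul (V i) \<and> closed (V i) \<and> 0 < v i) \<and>
     (\<exists>A B. 0 < A \<and> A \<le> B \<and>
       (\<forall>f. (\<lambda>i. (v i)\<^sup>2 * (norm (orth_proj ip (V i) f))\<^sup>2) summable_on I \<and>
          A * (norm f)\<^sup>2 \<le> (\<Sum>\<^sub>\<infinity>i\<in>I. (v i)\<^sup>2 * (norm (orth_proj ip (V i) f))\<^sup>2) \<and>
          (\<Sum>\<^sub>\<infinity>i\<in>I. (v i)\<^sup>2 * (norm (orth_proj ip (V i) f))\<^sup>2) \<le> B * (norm f)\<^sup>2))"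

definition fusion_synthesis ::
    "'i set \<Rightarrow> ('i \<Rightarrow> 'v::banach set) \<Rightarrow> ('i \<Rightarrow> real) \<Rightarrow> ('i \<Rightarrow> 'v) \<Rightarrow> 'v" where
  "fusion_synthesis I V v = (\<lambda>f \<in> hilbert_sum I V (\<lambda>_. norm). \<Sum>\<^sub>\<infinity>i\<in>I. v i *\<^sub>R f i)"

definition fusion_analysis ::
    "('v \<Rightarrow> 'v \<Rightarrow> 'k::rc_field) \<Rightarrow> 'i set \<Rightarrow> ('i \<Rightarrow> 'v::banach set) \<Rightarrow> ('i \<Rightarrow> real) \<Rightarrow> 'v \<Rightarrow> 'i \<Rightarrow> 'v" where
  "fusion_analysis ip I V v f = (\<lambda>i\<in>I. v i *\<^sub>R orth_proj ip (V i) f)"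

definition fusion_frame_op ::
    "('v \<Rightarrow> 'v \<Rightarrow> 'k::rc_field) \<Rightarrow> 'i set \<Rightarrow> ('i \<Rightarrow> 'v::banach set) \<Rightarrow> ('i \<Rightarrow> real) \<Rightarrow> 'v \<Rightarrow> 'v" where
  "fusion_frame_op ip I V v f = (\<Sum>\<^sub>\<infinity>i\<in>I. (v i)\<^sup>2 *\<^sub>R orth_proj ip (V i) f)"

definition fusion_frame_system ::
    "('k::rc_field \<Rightarrow> 'v::banach \<Rightarrow> 'v) \<Rightarrow> ('v \<Rightarrow> 'v \<Rightarrow> 'k) \<Rightarrow> 'i set \<Rightarrow> ('i \<Rightarrow> 'v set) \<Rightarrow> ('i \<Rightarrow> real) \<Rightarrow>
     ('i \<Rightarrow> 'j set) \<Rightarrow> ('i \<Rightarrow> 'j \<Rightarrow> 'v) \<Rightarrow> bool" where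
  "fusion_frame_system smul ip I V v J \<phi> \<longleftrightarrow>
     fusion_frame smul ip I V v \<and>
     (\<exists>A B. 0 < A \<and> A \<le> B \<and> (\<forall>i\<in>I. frame_with_bounds ip (V i) (J i) (\<phi> i) A B))"

definition global_frame :: "('i \<Rightarrow> real) \<Rightarrow> ('i \<Rightarrow> 'j \<Rightarrow> 'v::banach) \<Rightarrow> 'i \<times> 'j \<Rightarrow> 'v" where
  "global_frame v \<phi> = (\<lambda>(i, j). v i *\<^sub>R \<phi> i j)"

end

theory Submission
  imports Defs
begin

text \<open>For one local frame with bounds \<open>A \<le> B\<close> of \<open>V\<^sub>i\<close>, the Bessel inequality makes the synthesis series
  converge, and \<open>\<parallel>x - S x / B\<parallel>\<^sup>2 \<le> (1 - A / B) \<parallel>x\<parallel>\<^sup>2\<close> makes \<open>x \<mapsto> x + (g - S x) / B\<close> a contraction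
  of \<open>V\<^sub>i\<close>, so \<open>S x = g\<close> is solvable there. Then \<open>S\<^sup>-\<^sup>1 (\<Sum>\<^sub>j \<langle>f, \<phi>\<^sub>i\<^sub>j\<rangle> \<phi>\<^sub>i\<^sub>j)\<close> is the orthogonal projection
  of \<open>f\<close> onto \<open>V\<^sub>i\<close>, which yields the formula for \<open>C\<^sub>V\<close> componentwise. The common upper bound \<open>B\<close> and the upper
  fusion bound make the global family Bessel, so its synthesis series may be summed blockwise; each block
  is \<open>v\<^sub>i S S\<^sup>-\<^sup>1 f\<^sub>i\<close>, which yields the formula for \<open>D\<^sub>V\<close>. Finally \<open>S\<^sub>V = D\<^sub>V C\<^sub>V\<close>.\<close>

section \<open>Unconditional summation in Banach spaces and two real inequalities\<close>

text \<open>Two finite index sets containing \<open>F\<close> have partial sums close to that over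
  \<open>F\<close>, so the net of partial sums is Cauchy and completeness applies. Frame series need
  this criterion because they need not converge absolutely.\<close>

lemma summable_on_Cauchy_criterion:
  fixes f :: "'a \<Rightarrow> 'b::banach"
  assumes "\<And>e. 0 < e \<Longrightarrow> \<exists>F. finite F \<and> F \<subseteq> A \<and>
    (\<forall>G. finite G \<longrightarrow> G \<subseteq> A - F \<longrightarrow> norm (sum f G) < e)"
  shows "f summable_on A"
proof -
  have "\<exists>P. eventually P (finite_subsets_at_top A) \<and>
      (\<forall>G H. P G \<and> P H \<longrightarrow> dist (sum f G) (sum f H) < e)" if e: "0 < e" for e
  proof -
    obtain F where F: "finite F" "F \<subseteq> A"
      and small: "\<And>G. finite G \<Longrightarrow> G \<subseteq> A - F \<Longrightarrow> norm (sum f G) < e / 2"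
      using assms[OF half_gt_zero[OF e]] by blast
    have near: "dist (sum f G) (sum f F) < e / 2" if "finite G" "F \<subseteq> G" "G \<subseteq> A" for G
    proof -
      have "sum f G - sum f F = sum f (G - F)"
        using that by (simp add: sum_diff)
      then show ?thesis
        using small[of "G - F"] that by (auto simp: dist_norm)
    qed
    let ?P = "\<lambda>G. finite G \<and> F \<subseteq> G \<and> G \<subseteq> A"
    have "eventually ?P (finite_subsets_at_top A)"
      using F by (auto simp: eventually_finite_subsets_at_top)
    moreover have "dist (sum f G) (sum f H) < e"
      if "?P G" "?P H" for G H
      by (rule dist_triangle_half_l[OF near near]) (use that in auto)
    ultimately show ?thesis
      by (intro exI[of _ ?P]) simp
  qed
  then have "cauchy_filter (filtermap (sum f) (finite_subsets_at_top A))"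
    by (simp add: cauchy_filter_metric_filtermap)
  moreover have "complete (UNIV :: 'b set)"
    by (rule complete_UNIV)
  ultimately obtain L where "(sum f \<longlongrightarrow> L) (finite_subsets_at_top A)"
    using complete_uniform[where S = "UNIV :: 'b set"] by (force simp add: filterlim_def)
  then show ?thesis
    using summable_on_def has_sum_def by blast
qed

text \<open>Once the sum over \<open>F\<close> is within \<open>e\<close> of the total, a disjoint
  \<open>G\<close> has only the remainder left, all terms being nonnegative. This supplies the set
  \<open>F\<close> for the Cauchy criterion.\<close>

lemma summable_on_tail_small:
  fixes f :: "'a \<Rightarrow> real"
  assumes "f summable_on A" "\<And>x. x \<in> A \<Longrightarrow> 0 \<le> f x" "0 < e"
  obtains F where "finite F" "F \<subseteq> A" "\<And>G. finite G \<Longrightarrow> G \<subseteq> A - F \<Longrightarrow> sum f G < e"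
proof -
  have "(sum f \<longlongrightarrow> infsum f A) (finite_subsets_at_top A)"
    using assms(1) by (rule infsum_tendsto)
  then have "\<forall>\<^sub>F F in finite_subsets_at_top A. dist (sum f F) (infsum f A) < e"
    using \<open>0 < e\<close> by (rule tendstoD)
  then obtain F where F: "finite F" "F \<subseteq> A" "dist (sum f F) (infsum f A) < e"
    unfolding eventually_finite_subsets_at_top by blast
  show ?thesis
  proof (rule that[OF F(1,2)])
    fix G assume G: "finite G" "G \<subseteq> A - F"
    have "sum f F + sum f G = sum f (F \<union> G)"
      using F G by (intro sum.union_disjoint[symmetric]) auto
    also have "\<dots> \<le> infsum f A"
      using F G assms by (intro finite_sum_le_infsum) auto
    finally show "sum f G < e"
      using F(3) by (simp add: dist_real_def)
  qed
qed

text \<open>Applied below to closed subspaces, and to a closed ball in order to carry a norm bound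
  over to the limit.\<close>

lemma infsum_in_closed:
  fixes f :: "'a \<Rightarrow> 'b::{comm_monoid_add, t2_space}"
  assumes "f summable_on A" "closed U" "\<And>F. finite F \<Longrightarrow> F \<subseteq> A \<Longrightarrow> sum f F \<in> U"
  shows "infsum f A \<in> U"
proof (rule Lim_in_closed_set[OF assms(2)])
  show "(sum f \<longlongrightarrow> infsum f A) (finite_subsets_at_top A)"
    using assms(1) by (rule infsum_tendsto)
  show "\<forall>\<^sub>F F in finite_subsets_at_top A. sum f F \<in> U"
    using assms(3) by (intro eventually_finite_subsets_at_top_weakI)
qed simp

lemma sum_mult_le_sqrt:
  fixes a b :: "'a \<Rightarrow> real"
  shows "(\<Sum>i\<in>F. a i * b i) \<le> sqrt (\<Sum>i\<in>F. (a i)\<^sup>2) * sqrt (\<Sum>i\<in>F. (b i)\<^sup>2)"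
  unfolding real_sqrt_mult[symmetric]
  by (rule real_le_rsqrt) (rule Cauchy_Schwarz_ineq_sum)

text \<open>Closes the duality estimates below, in which Cauchy-Schwarz bounds a quantity by a
  multiple of its own square root.\<close>

lemma le_of_le_mult_sqrt:
  fixes s t :: real
  assumes "0 \<le> s" "0 \<le> t" "s \<le> sqrt t * sqrt s"
  shows "s \<le> t"
proof (cases "s = 0")
  case False
  then have "0 < sqrt s" using assms by simp
  moreover have "sqrt s * sqrt s \<le> sqrt t * sqrt s" using assms by simp
  ultimately have "sqrt s \<le> sqrt t" by (metis mult_le_cancel_right_pos)
  then show ?thesis by simp
qed (use assms in simp)

section \<open>Conjugation on the scalar field\<close>

context rc_field
begin

lemma conj_zero [simp]: "conj 0 = 0"
  using conj_add[of 0 0] by simp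

end

text \<open>Solving \<open>mult_conj\<close> for the conjugate gives a closed form, from which
  isometry, multiplicativity and involutivity are computed.\<close>

lemma conj_eq_divide: "conj x = of_real ((norm x)\<^sup>2) / (x::'k::rc_field)" if "x \<noteq> 0"
  using mult_conj[of x] that by (simp add: field_simps of_real_def)

lemma norm_conj [simp]: "norm (conj (x::'k::rc_field)) = norm x"
  by (cases "x = 0") (simp_all add: conj_eq_divide norm_divide power2_eq_square del: of_real_power of_real_mult)

lemma conj_mult: "conj (x * y) = conj x * conj (y::'k::rc_field)"
  by (cases "x = 0 \<or> y = 0") (auto simp: conj_eq_divide norm_mult power_mult_distrib)

lemma conj_conj [simp]: "conj (conj x) = (x::'k::rc_field)"
proof (cases "x = 0")
  case False
  then have "conj x \<noteq> 0" by (metis norm_conj norm_eq_zero)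
  then have "conj (conj x) = of_real ((norm x)\<^sup>2) / conj x" by (subst conj_eq_divide) simp_all
  then show ?thesis using False by (simp add: conj_eq_divide)
qed simp

lemma conj_of_real [simp]: "conj (of_real r :: 'k::rc_field) = of_real r"
  by (cases "r = 0") (simp_all add: conj_eq_divide power2_eq_square)

lemma mult_conj_of_real: "x * conj x = (of_real ((norm x)\<^sup>2) :: 'k::rc_field)"
  by (simp add: mult_conj of_real_def)

section \<open>Inner product calculus and orthogonal projections\<close>

context separable_hilbert_space
begin

lemma ip_zero_left [simp]: "ip 0 y = 0"
  using ip_add_left[of 0 0 y] by simp

lemma ip_add_right: "ip x (y + z) = ip x y + ip x z"
  by (simp add: ip_commute[of x] ip_add_left conj_add)

lemma ip_scale_right: "ip x (smul a y) = conj a * ip x y"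
  by (simp add: ip_commute[of x] ip_scale_left conj_mult)

lemma ip_zero_right [simp]: "ip x 0 = 0"
  using ip_add_right[of x 0 0] by simp

lemma ip_minus_left: "ip (- x) y = - ip x y"
  using ip_add_left[of x "- x" y] by (simp add: add_eq_0_iff2 minus_unique)

lemma ip_minus_right: "ip x (- y) = - ip x y"
  using ip_add_right[of x y "- y"] by (simp add: add_eq_0_iff2 minus_unique)

lemma ip_diff_left: "ip (x - y) z = ip x z - ip y z"
  using ip_add_left[of x "- y" z] ip_minus_left by simp

lemma ip_diff_right: "ip x (y - z) = ip x y - ip x z"
  using ip_add_right[of x y "- z"] ip_minus_right by simp

lemma ip_scaleR_left: "ip (r *\<^sub>R x) y = r *\<^sub>R ip x y"
  by (simp add: scale_of_real[symmetric] ip_scale_left scaleR_conv_of_real)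

lemma ip_scaleR_right: "ip x (r *\<^sub>R y) = r *\<^sub>R ip x y"
  by (simp add: scale_of_real[symmetric] ip_scale_right scaleR_conv_of_real)

lemma ip_sum_left: "ip (\<Sum>i\<in>F. f i) y = (\<Sum>i\<in>F. ip (f i) y)"
  by (induction F rule: infinite_finite_induct) (simp_all add: ip_add_left)

lemma ip_sum_right: "ip x (\<Sum>i\<in>F. f i) = (\<Sum>i\<in>F. ip x (f i))"
  by (induction F rule: infinite_finite_induct) (simp_all add: ip_add_right)

lemma norm_ip_commute: "norm (ip x y) = norm (ip y x)"
  by (metis ip_commute norm_conj)

lemma scale_scaleR: "smul a (r *\<^sub>R x) = r *\<^sub>R smul a x"
  by (simp add: scale_of_real[symmetric] mult.commute)

text \<open>The Cauchy-Schwarz inequality for scalars in any \<open>rc_field\<close>.\<close>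

lemma norm_ip_le: "norm (ip x y) \<le> norm x * norm y"
proof (cases "y = 0")
  case False
  define a where "a = ip x y"
  define b where "b = (norm y)\<^sup>2"
  \<comment> \<open>Up to the factor \<open>b\<close>, this is the component of \<open>x\<close>
    orthogonal to \<open>y\<close>; the scaling avoids division.\<close>
  define z where "z = b *\<^sub>R x - smul a y"
  have b: "0 < b" using False by (simp add: b_def)
  have yx: "ip y x = conj a" by (simp add: a_def ip_commute[of y x])
  have "of_real ((norm z)\<^sup>2) = ip z z" by (rule ip_norm[symmetric])
  also have "\<dots> = of_real b * of_real b * ip x x - of_real b * (a * conj a)"
    by (simp add: z_def ip_diff_left ip_diff_right ip_scale_left ip_scale_right
        scale_of_real[symmetric] yx a_def[symmetric] ip_norm[of y] b_def[symmetric] algebra_simps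
        del: of_real_power)
  also have "\<dots> = of_real (b * (b * (norm x)\<^sup>2 - (norm a)\<^sup>2))"
    by (simp add: ip_norm mult_conj_of_real algebra_simps)
  finally have "(norm z)\<^sup>2 = b * (b * (norm x)\<^sup>2 - (norm a)\<^sup>2)"
    by (simp only: of_real_eq_iff)
  then have "0 \<le> b * (b * (norm x)\<^sup>2 - (norm a)\<^sup>2)"
    by (metis zero_le_power2)
  then have "(norm a)\<^sup>2 \<le> b * (norm x)\<^sup>2"
    using b by (simp add: zero_le_mult_iff)
  then have "(norm a)\<^sup>2 \<le> (norm x * norm y)\<^sup>2"
    by (simp add: b_def power_mult_distrib mult.commute)
  then show ?thesis
    unfolding a_def by (rule power2_le_imp_le) simp
qed simp

lemma bounded_linear_ip_left: "bounded_linear (\<lambda>x. ip x y)"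
  by (rule bounded_linear_intro[of _ "norm y"])
    (simp_all add: ip_add_left ip_scaleR_left norm_ip_le)

lemma bounded_linear_ip_right: "bounded_linear (ip x)"
  by (rule bounded_linear_intro[of _ "norm x"])
    (simp_all add: ip_add_right ip_scaleR_right norm_ip_le mult.commute[of _ "norm x"])

lemma subspace_scaleR: "subspace U \<Longrightarrow> x \<in> U \<Longrightarrow> r *\<^sub>R x \<in> U"
  by (metis scale_of_real subspace_scale)

text \<open>The difference of two candidates lies in \<open>U\<close> and is orthogonal to itself,
  so the definite description has at most one witness.\<close>

lemma orth_proj_eqI:
  assumes "subspace U" "p \<in> U" "\<And>u. u \<in> U \<Longrightarrow> ip (f - p) u = 0"
  shows "orth_proj ip U f = p"
  unfolding orth_proj_def
proof (rule the_equality)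
  fix q assume q: "q \<in> U \<and> (\<forall>u\<in>U. ip (f - q) u = 0)"
  have "p - q \<in> U" using assms q subspace_diff by blast
  then have "ip (f - q) (p - q) - ip (f - p) (p - q) = 0"
    using assms q by simp
  then have "ip (p - q) (p - q) = 0"
    by (simp add: ip_diff_left)
  then show "q = p" by (simp add: ip_norm)
qed (use assms in auto)

section \<open>Bessel families and convergence of their synthesis series\<close>

text \<open>The bound is stated over finite index sets, so that summability becomes a conclusion,
  and only for vectors of \<open>K\<close>, which is all that a local frame provides
  directly.\<close>

definition bessel :: "'v set \<Rightarrow> 'j set \<Rightarrow> ('j \<Rightarrow> 'v) \<Rightarrow> real \<Rightarrow> bool" where
  "bessel K J \<psi> B \<longleftrightarrow> 0 \<le> B \<and> subspace K \<and> (\<forall>j\<in>J. \<psi> j \<in> K) \<and>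
     (\<forall>F. \<forall>f\<in>K. finite F \<longrightarrow> F \<subseteq> J \<longrightarrow> (\<Sum>j\<in>F. (norm (ip f (\<psi> j)))\<^sup>2) \<le> B * (norm f)\<^sup>2)"

lemma sum_scale_in:
  assumes "bessel K J \<psi> B" "F \<subseteq> J"
  shows "(\<Sum>j\<in>F. smul (c j) (\<psi> j)) \<in> K"
  using assms by (intro subspace_sum subspace_scale) (auto simp: bessel_def)

text \<open>Duality: the finite sum \<open>g\<close> lies in \<open>K\<close>, so the Bessel bound
  applies to \<open>g\<close> itself. Expanding \<open>ip g g\<close> and using Cauchy-Schwarz
  leaves one factor \<open>norm g\<close> to cancel.\<close>

lemma norm_sum_scale_le:
  assumes "bessel K J \<psi> B" "finite F" "F \<subseteq> J"
  shows "(norm (\<Sum>j\<in>F. smul (c j) (\<psi> j)))\<^sup>2 \<le> B * (\<Sum>j\<in>F. (norm (c j))\<^sup>2)"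
proof -
  define g where "g = (\<Sum>j\<in>F. smul (c j) (\<psi> j))"
  have "g \<in> K" unfolding g_def using assms by (intro sum_scale_in)
  then have bess: "(\<Sum>j\<in>F. (norm (ip g (\<psi> j)))\<^sup>2) \<le> B * (norm g)\<^sup>2" and "0 \<le> B"
    using assms by (auto simp: bessel_def)
  have "(norm g)\<^sup>2 = norm (ip g g)" by (simp add: ip_norm norm_power)
  also have "ip g g = (\<Sum>j\<in>F. c j * ip (\<psi> j) g)"
    by (subst g_def) (simp add: ip_sum_left ip_scale_left)
  also have "norm \<dots> \<le> (\<Sum>j\<in>F. norm (c j) * norm (ip g (\<psi> j)))"
    by (intro sum_norm_le) (simp add: norm_mult norm_ip_commute[of g])
  also have "\<dots> \<le> sqrt (\<Sum>j\<in>F. (norm (c j))\<^sup>2) * sqrt (\<Sum>j\<in>F. (norm (ip g (\<psi> j)))\<^sup>2)"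
    by (rule sum_mult_le_sqrt)
  also have "\<dots> \<le> sqrt (\<Sum>j\<in>F. (norm (c j))\<^sup>2) * sqrt (B * (norm g)\<^sup>2)"
    using bess by (intro mult_left_mono) (auto intro: sum_nonneg)
  also have "\<dots> = sqrt (B * (\<Sum>j\<in>F. (norm (c j))\<^sup>2)) * sqrt ((norm g)\<^sup>2)"
    by (simp add: real_sqrt_mult)
  finally show ?thesis
    unfolding g_def[symmetric]
    by (rule le_of_le_mult_sqrt[rotated 2]) (use \<open>0 \<le> B\<close> in \<open>auto intro!: mult_nonneg_nonneg sum_nonneg\<close>)
qed

text \<open>The vectors of \<open>\<psi>\<close> only see the component of \<open>f\<close> in \<open>K\<close>, but no projection onto \<open>K\<close> is
  available yet; duality with the synthesis operator replaces it.\<close>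

lemma bessel_UNIV:
  assumes "bessel K J \<psi> B"
  shows "bessel UNIV J \<psi> B"
  unfolding bessel_def
proof (intro conjI ballI allI impI)
  show "0 \<le> B" using assms by (simp add: bessel_def)
  fix F f assume F: "finite F" "F \<subseteq> J"
  let ?c = "\<lambda>j. ip f (\<psi> j)"
  define s where "s = (\<Sum>j\<in>F. (norm (?c j))\<^sup>2)"
  have s: "0 \<le> s" unfolding s_def by (intro sum_nonneg) simp
  have "of_real s = (\<Sum>j\<in>F. conj (?c j) * ?c j)"
    unfolding s_def of_real_sum mult_conj_of_real[symmetric] by (simp add: mult.commute)
  also have "\<dots> = ip f (\<Sum>j\<in>F. smul (?c j) (\<psi> j))"
    by (simp add: ip_sum_right ip_scale_right)
  finally have "s = norm (ip f (\<Sum>j\<in>F. smul (?c j) (\<psi> j)))"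
    using s by (metis abs_of_nonneg norm_of_real)
  also have "\<dots> \<le> norm f * norm (\<Sum>j\<in>F. smul (?c j) (\<psi> j))"
    by (rule norm_ip_le)
  also have "\<dots> \<le> norm f * sqrt (B * s)"
    unfolding s_def using norm_sum_scale_le[OF assms F]
    by (intro mult_left_mono real_le_rsqrt) auto
  also have "\<dots> = sqrt (B * (norm f)\<^sup>2) * sqrt s"
    by (simp add: real_sqrt_mult)
  finally show "(\<Sum>j\<in>F. (norm (?c j))\<^sup>2) \<le> B * (norm f)\<^sup>2"
    unfolding s_def[symmetric]
    by (rule le_of_le_mult_sqrt[OF s, rotated]) (use \<open>0 \<le> B\<close> in simp)
qed auto

lemma bessel_coefficients:
  assumes "bessel K J \<psi> B"
  shows "(\<lambda>j. (norm (ip f (\<psi> j)))\<^sup>2) summable_on J"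
    and "(\<Sum>\<^sub>\<infinity>j\<in>J. (norm (ip f (\<psi> j)))\<^sup>2) \<le> B * (norm f)\<^sup>2"
proof -
  have le: "(\<Sum>j\<in>F. (norm (ip f (\<psi> j)))\<^sup>2) \<le> B * (norm f)\<^sup>2" if "finite F" "F \<subseteq> J" for F
    using bessel_UNIV[OF assms] that by (auto simp: bessel_def)
  show sm: "(\<lambda>j. (norm (ip f (\<psi> j)))\<^sup>2) summable_on J"
    by (intro nonneg_bdd_above_summable_on bdd_aboveI) (use le in auto)
  show "(\<Sum>\<^sub>\<infinity>j\<in>J. (norm (ip f (\<psi> j)))\<^sup>2) \<le> B * (norm f)\<^sup>2"
    using sm le by (rule infsum_le_finite_sums)
qed

lemma bessel_summable:
  assumes "bessel K J \<psi> B" "(\<lambda>j. (norm (c j))\<^sup>2) summable_on J"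
  shows "(\<lambda>j. smul (c j) (\<psi> j)) summable_on J"
proof (rule summable_on_Cauchy_criterion)
  fix e :: real assume e: "0 < e"
  have B: "0 \<le> B" using assms by (simp add: bessel_def)
  \<comment> \<open>Dividing by \<open>B + 1\<close> keeps the threshold meaningful when
    \<open>B = 0\<close>.\<close>
  obtain F where F: "finite F" "F \<subseteq> J"
    and small: "\<And>G. finite G \<Longrightarrow> G \<subseteq> J - F \<Longrightarrow> (\<Sum>j\<in>G. (norm (c j))\<^sup>2) < e\<^sup>2 / (B + 1)"
    using summable_on_tail_small[OF assms(2), of "e\<^sup>2 / (B + 1)"] e B by auto
  have "norm (\<Sum>j\<in>G. smul (c j) (\<psi> j)) < e" if G: "finite G" "G \<subseteq> J - F" for G
  proof -
    have "(norm (\<Sum>j\<in>G. smul (c j) (\<psi> j)))\<^sup>2 \<le> B * (\<Sum>j\<in>G. (norm (c j))\<^sup>2)"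
      using G by (intro norm_sum_scale_le[OF assms(1)]) auto
    also have "\<dots> \<le> (B + 1) * (\<Sum>j\<in>G. (norm (c j))\<^sup>2)"
      by (intro mult_right_mono sum_nonneg) auto
    also have "\<dots> < e\<^sup>2"
      using small[OF G] B by (simp add: field_simps)
    finally show ?thesis
      by (rule power2_less_imp_less) (use e in simp)
  qed
  then show "\<exists>F. finite F \<and> F \<subseteq> J \<and>
      (\<forall>G. finite G \<longrightarrow> G \<subseteq> J - F \<longrightarrow> norm (\<Sum>j\<in>G. smul (c j) (\<psi> j)) < e)"
    using F by blast
qed

lemma bessel_infsum_in:
  assumes "bessel K J \<psi> B" "closed K" "(\<lambda>j. (norm (c j))\<^sup>2) summable_on J"
  shows "(\<Sum>\<^sub>\<infinity>j\<in>J. smul (c j) (\<psi> j)) \<in> K"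
  by (intro infsum_in_closed bessel_summable[OF assms(1,3)] assms(2) sum_scale_in[OF assms(1)])

lemma bessel_norm_infsum_le:
  assumes "bessel K J \<psi> B" "(\<lambda>j. (norm (c j))\<^sup>2) summable_on J"
  shows "(norm (\<Sum>\<^sub>\<infinity>j\<in>J. smul (c j) (\<psi> j)))\<^sup>2 \<le> B * (\<Sum>\<^sub>\<infinity>j\<in>J. (norm (c j))\<^sup>2)"
proof -
  let ?r = "sqrt (B * (\<Sum>\<^sub>\<infinity>j\<in>J. (norm (c j))\<^sup>2))"
  have B: "0 \<le> B" using assms by (simp add: bessel_def)
  have nn: "0 \<le> B * (\<Sum>\<^sub>\<infinity>j\<in>J. (norm (c j))\<^sup>2)"
    using B by (intro mult_nonneg_nonneg infsum_nonneg) auto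
  have "(\<Sum>\<^sub>\<infinity>j\<in>J. smul (c j) (\<psi> j)) \<in> cball 0 ?r"
  proof (intro infsum_in_closed bessel_summable[OF assms] closed_cball)
    fix F assume F: "finite F" "F \<subseteq> J"
    have "(norm (\<Sum>j\<in>F. smul (c j) (\<psi> j)))\<^sup>2 \<le> B * (\<Sum>j\<in>F. (norm (c j))\<^sup>2)"
      using F by (rule norm_sum_scale_le[OF assms(1)])
    also have "\<dots> \<le> B * (\<Sum>\<^sub>\<infinity>j\<in>J. (norm (c j))\<^sup>2)"
      using F B assms(2) by (intro mult_left_mono finite_sum_le_infsum) auto
    finally show "(\<Sum>j\<in>F. smul (c j) (\<psi> j)) \<in> cball 0 ?r"
      by (simp add: real_le_rsqrt)
  qed
  then have "norm (\<Sum>\<^sub>\<infinity>j\<in>J. smul (c j) (\<psi> j)) \<le> ?r" by simp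
  then have "(norm (\<Sum>\<^sub>\<infinity>j\<in>J. smul (c j) (\<psi> j)))\<^sup>2 \<le> ?r\<^sup>2"
    by (intro power_mono) auto
  then show ?thesis using nn by simp
qed

lemma ip_infsum_left:
  assumes "bessel K J \<psi> B" "(\<lambda>j. (norm (c j))\<^sup>2) summable_on J"
  shows "((\<lambda>j. c j * ip (\<psi> j) w) has_sum ip (\<Sum>\<^sub>\<infinity>j\<in>J. smul (c j) (\<psi> j)) w) J"
  using has_sum_bounded_linear[OF bounded_linear_ip_left has_sum_infsum[OF bessel_summable[OF assms]], of w]
  by (simp add: ip_scale_left)

lemma ip_infsum_right:
  assumes "bessel K J \<psi> B" "(\<lambda>j. (norm (c j))\<^sup>2) summable_on J"
  shows "((\<lambda>j. conj (c j) * ip w (\<psi> j)) has_sum ip w (\<Sum>\<^sub>\<infinity>j\<in>J. smul (c j) (\<psi> j))) J"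
  using has_sum_bounded_linear[OF bounded_linear_ip_right has_sum_infsum[OF bessel_summable[OF assms]], of w]
  by (simp add: ip_scale_right)

end

section \<open>A single frame of a closed subspace: inverse frame operator and projection\<close>

locale local_frame = separable_hilbert_space smul ip
  for smul :: "'k::rc_field \<Rightarrow> 'v::banach \<Rightarrow> 'v" and ip +
  fixes K :: "'v set" and J :: "'j set" and \<psi> :: "'j \<Rightarrow> 'v" and A B :: real
  assumes subspace_K: "subspace K" and closed_K: "closed K"
    and frame: "frame_with_bounds ip K J \<psi> A B"
begin

abbreviation S where "S \<equiv> frame_op smul ip K J \<psi>"
abbreviation S_inv where "S_inv \<equiv> inv_frame_op smul ip K J \<psi>"

lemma bounds_pos: "0 < A" "A \<le> B" "0 < B"
  using frame by (auto simp: frame_with_bounds_def)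

lemma bessel_K: "bessel K J \<psi> B"
  unfolding bessel_def
proof (intro conjI ballI allI impI)
  fix F f assume f: "f \<in> K" and F: "finite F" "F \<subseteq> J"
  have "(\<lambda>j. (norm (ip f (\<psi> j)))\<^sup>2) summable_on J"
    and le: "(\<Sum>\<^sub>\<infinity>j\<in>J. (norm (ip f (\<psi> j)))\<^sup>2) \<le> B * (norm f)\<^sup>2"
    using frame f by (auto simp: frame_with_bounds_def)
  then have "(\<Sum>j\<in>F. (norm (ip f (\<psi> j)))\<^sup>2) \<le> (\<Sum>\<^sub>\<infinity>j\<in>J. (norm (ip f (\<psi> j)))\<^sup>2)"
    using F by (intro finite_sum_le_infsum) auto
  then show "(\<Sum>j\<in>F. (norm (ip f (\<psi> j)))\<^sup>2) \<le> B * (norm f)\<^sup>2" using le by simp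
qed (use bounds_pos subspace_K frame in \<open>auto simp: frame_with_bounds_def\<close>)

lemmas coefficients_summable = bessel_coefficients(1)[OF bessel_K]

lemma frame_op_eq: "f \<in> K \<Longrightarrow> S f = (\<Sum>\<^sub>\<infinity>j\<in>J. smul (ip f (\<psi> j)) (\<psi> j))"
  by (simp add: frame_op_def)

lemma frame_op_in: "f \<in> K \<Longrightarrow> S f \<in> K"
  by (simp add: frame_op_eq bessel_infsum_in[OF bessel_K closed_K coefficients_summable])

lemma frame_op_diff:
  assumes "x \<in> K" "y \<in> K"
  shows "S (x - y) = S x - S y"
proof -
  note sm = has_sum_infsum[OF bessel_summable[OF bessel_K coefficients_summable]]
  have "((\<lambda>j. smul (ip x (\<psi> j)) (\<psi> j) + (- 1) *\<^sub>R smul (ip y (\<psi> j)) (\<psi> j)) has_sum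
      S x + (- 1) *\<^sub>R S y) J"
    unfolding frame_op_eq[OF assms(1)] frame_op_eq[OF assms(2)]
    by (intro has_sum_add has_sum_scaleR sm)
  moreover have "x - y \<in> K" using assms subspace_K subspace_diff by blast
  ultimately show ?thesis
    by (simp add: frame_op_eq infsumI ip_diff_left scale_left_diff_distrib)
qed

text \<open>Identifies the middle term of the frame inequality with a value of the inner product, so
  that the bounds of the frame become bounds on \<open>S\<close>.\<close>

lemma ip_frame_op_self:
  assumes "f \<in> K"
  shows "ip (S f) f = of_real (\<Sum>\<^sub>\<infinity>j\<in>J. (norm (ip f (\<psi> j)))\<^sup>2)"
proof -
  have "((\<lambda>j. ip f (\<psi> j) * ip (\<psi> j) f) has_sum ip (S f) f) J"
    unfolding frame_op_eq[OF assms] by (rule ip_infsum_left[OF bessel_K coefficients_summable])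
  moreover have "ip f (\<psi> j) * ip (\<psi> j) f = of_real ((norm (ip f (\<psi> j)))\<^sup>2)" for j
    by (simp only: ip_commute[of "\<psi> j" f] mult_conj_of_real)
  moreover have "((\<lambda>j. of_real ((norm (ip f (\<psi> j)))\<^sup>2) :: 'k) has_sum
      of_real (\<Sum>\<^sub>\<infinity>j\<in>J. (norm (ip f (\<psi> j)))\<^sup>2)) J"
    by (intro has_sum_bounded_linear[OF bounded_linear_of_real] has_sum_infsum coefficients_summable)
  ultimately show ?thesis
    by (metis (no_types, lifting) has_sum_cong infsumI)
qed

text \<open>With \<open>q\<close> the coefficient sum of \<open>f\<close>, expand the square: the
  cross terms give \<open>- 2 * q / B\<close>, the Bessel bound on \<open>S f\<close> returns at
  most \<open>q / B\<close>, and the lower frame bound controls the remaining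
  \<open>- q / B\<close>.\<close>

lemma frame_op_contraction:
  assumes "f \<in> K"
  shows "(norm (f - (1 / B) *\<^sub>R S f))\<^sup>2 \<le> (1 - A / B) * (norm f)\<^sup>2"
proof -
  define q where "q = (\<Sum>\<^sub>\<infinity>j\<in>J. (norm (ip f (\<psi> j)))\<^sup>2)"
  have q: "A * (norm f)\<^sup>2 \<le> q"
    using frame assms by (auto simp: frame_with_bounds_def q_def)
  have Sf: "(norm (S f))\<^sup>2 \<le> B * q"
    unfolding q_def frame_op_eq[OF assms] by (rule bessel_norm_infsum_le[OF bessel_K coefficients_summable])
  have 1: "ip (S f) f = of_real q" "ip f (S f) = of_real q"
    using ip_frame_op_self[OF assms] by (simp_all add: q_def ip_commute[of f "S f"])
  have "of_real ((norm (f - (1 / B) *\<^sub>R S f))\<^sup>2) =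
      ip (f - (1 / B) *\<^sub>R S f) (f - (1 / B) *\<^sub>R S f)"
    by (rule ip_norm[symmetric])
  also have "\<dots> = of_real ((norm f)\<^sup>2 - 2 * q / B + (norm (S f))\<^sup>2 / B\<^sup>2)"
    by (simp add: ip_diff_left ip_diff_right ip_scaleR_left ip_scaleR_right 1
        ip_norm[of f] ip_norm[of "S f"] scaleR_conv_of_real power2_eq_square diff_divide_distrib)
  finally have "(norm (f - (1 / B) *\<^sub>R S f))\<^sup>2 = (norm f)\<^sup>2 - 2 * q / B + (norm (S f))\<^sup>2 / B\<^sup>2"
    by (simp only: of_real_eq_iff)
  also have "\<dots> \<le> (norm f)\<^sup>2 - 2 * q / B + (B * q) / B\<^sup>2"
    using Sf by (intro add_left_mono divide_right_mono) auto
  also have "\<dots> = (norm f)\<^sup>2 - q / B"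
    using bounds_pos by (simp add: field_simps power2_eq_square)
  also have "\<dots> \<le> (norm f)\<^sup>2 - (A * (norm f)\<^sup>2) / B"
    using q bounds_pos by (intro diff_left_mono divide_right_mono) auto
  finally show ?thesis by (simp add: algebra_simps)
qed

lemma frame_op_surj:
  assumes "g \<in> K"
  shows "\<exists>x\<in>K. S x = g"
proof -
  \<comment> \<open>The fixed points of \<open>T\<close> in \<open>K\<close> are exactly the
    solutions of \<open>S x = g\<close> there, and differences evolve by the contraction just
    estimated.\<close>
  define T where "T x = x + (1 / B) *\<^sub>R (g - S x)" for x
  have "\<exists>!x\<in>K. T x = x"
  proof (rule Banach_fix)
    show "complete K" using closed_K by (simp add: complete_eq_closed)
    show "K \<noteq> {}" using assms by auto
    show "0 \<le> sqrt (1 - A / B)" "sqrt (1 - A / B) < 1" using bounds_pos by auto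
    show "T ` K \<subseteq> K"
      unfolding T_def using subspace_K assms frame_op_in
      by (auto intro!: subspace_add subspace_diff subspace_scaleR)
    show "dist (T x) (T y) \<le> sqrt (1 - A / B) * dist x y" if xy: "x \<in> K" "y \<in> K" for x y
    proof -
      have "T x - T y = (x - y) - (1 / B) *\<^sub>R S (x - y)"
        using xy by (simp add: T_def frame_op_diff algebra_simps)
      then have "(norm (T x - T y))\<^sup>2 \<le> (1 - A / B) * (norm (x - y))\<^sup>2"
        using frame_op_contraction[of "x - y"] xy subspace_K subspace_diff by auto
      then have "norm (T x - T y) \<le> sqrt ((1 - A / B) * (norm (x - y))\<^sup>2)"
        by (rule real_le_rsqrt)
      then show "dist (T x) (T y) \<le> sqrt (1 - A / B) * dist x y"
        by (simp add: dist_norm real_sqrt_mult)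
    qed
  qed
  then obtain x where "x \<in> K" "T x = x" by blast
  then show ?thesis using bounds_pos by (auto simp: T_def)
qed

text \<open>Surjectivity on \<open>K\<close> makes \<open>inv_into\<close> a right inverse with
  values in \<open>K\<close>.\<close>

lemma inv_frame_op:
  assumes "g \<in> K"
  shows "S_inv g \<in> K" "S (S_inv g) = g"
proof -
  have "g \<in> S ` K" using frame_op_surj[OF assms] by blast
  then show "S_inv g \<in> K" "S (S_inv g) = g"
    using assms by (simp_all add: inv_frame_op_def inv_into_into f_inv_into_f)
qed

text \<open>For \<open>x = S_inv g\<close>, the lower bound and Cauchy-Schwarz give
  \<open>A * (norm x)\<^sup>2 \<le> norm g * norm x\<close>. The constant depends only on
  \<open>A\<close>, hence is uniform over all local frames.\<close>

lemma norm_inv_frame_op_le: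
  assumes "g \<in> K"
  shows "norm (S_inv g) \<le> norm g / A"
proof -
  let ?x = "S_inv g"
  have x: "?x \<in> K" "S ?x = g" using inv_frame_op[OF assms] by auto
  define q where "q = (\<Sum>\<^sub>\<infinity>j\<in>J. (norm (ip ?x (\<psi> j)))\<^sup>2)"
  have q: "A * (norm ?x)\<^sup>2 \<le> q"
    using frame x by (auto simp: frame_with_bounds_def q_def)
  also have "q \<le> norm (of_real q :: 'k)" by simp
  also have "(of_real q :: 'k) = ip g ?x"
    using ip_frame_op_self[OF x(1)] by (simp add: x q_def)
  also have "norm \<dots> \<le> norm g * norm ?x" by (rule norm_ip_le)
  finally have "(A * norm ?x) * norm ?x \<le> norm g * norm ?x"
    by (simp add: power2_eq_square mult.assoc)
  then have "A * norm ?x \<le> norm g"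
    by (cases "?x = 0") auto
  then show ?thesis using bounds_pos by (simp add: field_simps)
qed

text \<open>Existence of the projection comes from the frame. Writing a test vector as
  \<open>u = S w\<close> and moving \<open>S\<close> across the inner product reduces orthogonality
  of the residual to \<open>S (S_inv g) = g\<close>, where \<open>g\<close> is the synthesis of the
  coefficients of \<open>f\<close>.\<close>

lemma orth_proj_eq:
  "orth_proj ip K f = S_inv (\<Sum>\<^sub>\<infinity>j\<in>J. smul (ip f (\<psi> j)) (\<psi> j))" (is "_ = S_inv ?g")
  and orth_proj_in: "orth_proj ip K f \<in> K"
  and ip_orth_proj: "u \<in> K \<Longrightarrow> ip (orth_proj ip K f) u = ip f u"
proof -
  let ?p = "S_inv ?g"
  have g: "?g \<in> K" by (rule bessel_infsum_in[OF bessel_K closed_K coefficients_summable])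
  note p = inv_frame_op[OF g]
  have orth: "ip ?p u = ip f u" if u: "u \<in> K" for u
  proof -
    obtain w where w: "w \<in> K" "S w = u" using frame_op_surj[OF u] by blast
    note R = ip_infsum_right[OF bessel_K coefficients_summable, of w, folded frame_op_eq[OF w(1)], unfolded w]
    note L = ip_infsum_left[OF bessel_K coefficients_summable, of _ w]
    \<comment> \<open>The expansions \<open>R\<close> and \<open>L\<close> have the same terms, so
      both sides of each self-adjointness step are sums of one series.\<close>
    have eq: "conj (ip w (\<psi> j)) * ip h (\<psi> j) = ip h (\<psi> j) * ip (\<psi> j) w" for h j
      by (simp add: ip_commute[of "\<psi> j" w])
    have "ip ?p u = ip (S ?p) w"
      using R[of ?p] L[of ?p] unfolding eq frame_op_eq[OF p(1)] by (rule has_sum_unique)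
    also have "\<dots> = ip ?g w" by (simp add: p)
    also have "\<dots> = ip f u"
      using L[of f] R[of f] unfolding eq by (rule has_sum_unique)
    finally show ?thesis .
  qed
  show eq: "orth_proj ip K f = ?p"
    using p orth subspace_K by (intro orth_proj_eqI) (auto simp: ip_diff_left)
  show "orth_proj ip K f \<in> K" using p eq by simp
  show "ip (orth_proj ip K f) u = ip f u" if "u \<in> K" using orth[OF that] eq by simp
qed

lemma orth_proj_scaleR: "orth_proj ip K (r *\<^sub>R f) = r *\<^sub>R orth_proj ip K f"
  using subspace_K orth_proj_in
  by (intro orth_proj_eqI)
    (auto simp: ip_diff_left ip_scaleR_left ip_orth_proj subspace_scaleR)

end


section \<open>Coefficient families over the disjoint union versus families of blocks\<close>

lemma l2_norm_power2: "(l2_norm J c)\<^sup>2 = (\<Sum>\<^sub>\<infinity>j\<in>J. (norm (c j))\<^sup>2)"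
  unfolding l2_norm_def by (intro real_sqrt_pow2 infsum_nonneg) simp

text \<open>Tonelli for nonnegative terms: each block sums to its squared \<open>l2_norm\<close>,
  and these squares are summable. Membership is what allows the extensional \<open>synthesis\<close>
  to be evaluated on the joined family.\<close>

lemma l2_join_in_l2:
  fixes d :: "'i \<Rightarrow> 'j \<Rightarrow> 'k::real_normed_vector"
  assumes "d \<in> hilbert_sum I (\<lambda>i. l2 (J i)) (\<lambda>i. l2_norm (J i))"
  shows "l2_join I J d \<in> l2 (Sigma I J)"
proof -
  have d: "d i \<in> l2 (J i)" if "i \<in> I" for i
    using assms that by (auto simp: hilbert_sum_def)
  have "(\<lambda>p. (norm (l2_join I J d p))\<^sup>2) summable_on Sigma I J"
  proof (rule summable_on_SigmaI)
    fix i assume "i \<in> I"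
    then have "(\<lambda>j. (norm (d i j))\<^sup>2) summable_on J i"
      using d by (simp add: l2_def)
    then have "((\<lambda>j. (norm (d i j))\<^sup>2) has_sum (l2_norm (J i) (d i))\<^sup>2) (J i)"
      unfolding l2_norm_power2 by (rule has_sum_infsum)
    then show "((\<lambda>j. (norm (l2_join I J d (i, j)))\<^sup>2) has_sum (l2_norm (J i) (d i))\<^sup>2) (J i)"
      using \<open>i \<in> I\<close> assms by (subst has_sum_cong) (auto simp: l2_join_def)
  next
    show "(\<lambda>i. (l2_norm (J i) (d i))\<^sup>2) summable_on I"
      using assms by (simp add: hilbert_sum_def)
  qed simp
  then show ?thesis
    using assms by (simp add: l2_def l2_join_def)
qed

lemma l2_split_in_hilbert_sum:
  fixes c :: "'i \<times> 'j \<Rightarrow> 'k::real_normed_vector"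
  assumes "c \<in> l2 (Sigma I J)"
  shows "l2_split I J c \<in> hilbert_sum I (\<lambda>i. l2 (J i)) (\<lambda>i. l2_norm (J i))"
proof -
  have sm: "(\<lambda>(i, j). (norm (c (i, j)))\<^sup>2) summable_on Sigma I J"
    using assms by (simp add: l2_def case_prod_unfold)
  have eq: "l2_split I J c i j = c (i, j)" if "i \<in> I" "j \<in> J i" for i j
    using assms that by (simp add: l2_split_def)
  have "l2_split I J c i \<in> l2 (J i)" if "i \<in> I" for i
  proof -
    have "(\<lambda>j. (norm (l2_split I J c i j))\<^sup>2) summable_on J i"
      using summable_on_SigmaD1[OF sm that] that eq by (subst summable_on_cong) auto
    then show ?thesis
      using assms that by (simp add: l2_def l2_split_def)
  qed
  moreover have "(\<lambda>i. (l2_norm (J i) (l2_split I J c i))\<^sup>2) summable_on I"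
  proof (subst summable_on_cong)
    show "(\<lambda>i. \<Sum>\<^sub>\<infinity>j\<in>J i. (norm (c (i, j)))\<^sup>2) summable_on I"
      by (rule summable_on_Sigma_banach[OF sm])
    show "(l2_norm (J i) (l2_split I J c i))\<^sup>2 = (\<Sum>\<^sub>\<infinity>j\<in>J i. (norm (c (i, j)))\<^sup>2)" if "i \<in> I" for i
      unfolding l2_norm_power2 using that eq by (intro infsum_cong) simp
  qed
  moreover have "l2_split I J c \<in> extensional I"
    using assms by (simp add: l2_split_def)
  ultimately show ?thesis
    by (simp add: hilbert_sum_def PiE_def)
qed

section \<open>The global frame and the three operator identities\<close>

text \<open>Fixes constants that the definitions quantify existentially: common local bounds
  \<open>A\<close>, \<open>B\<close> and an upper fusion bound \<open>B\<^sub>V\<close>.\<close>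

locale fusion_system = separable_hilbert_space smul ip
  for smul :: "'k::rc_field \<Rightarrow> 'v::banach \<Rightarrow> 'v" and ip +
  fixes I :: "'i set" and V :: "'i \<Rightarrow> 'v set" and v :: "'i \<Rightarrow> real"
    and J :: "'i \<Rightarrow> 'j set" and \<phi> :: "'i \<Rightarrow> 'j \<Rightarrow> 'v" and A B B\<^sub>V :: real
  assumes local_frames: "i \<in> I \<Longrightarrow> local_frame smul ip (V i) (J i) (\<phi> i) A B"
    and bounds: "0 < A" "0 \<le> B" "0 \<le> B\<^sub>V"
    and fusion_summable: "(\<lambda>i. (v i)\<^sup>2 * (norm (orth_proj ip (V i) f))\<^sup>2) summable_on I"
    and fusion_upper:
      "(\<Sum>\<^sub>\<infinity>i\<in>I. (v i)\<^sup>2 * (norm (orth_proj ip (V i) f))\<^sup>2) \<le> B\<^sub>V * (norm f)\<^sup>2"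
begin

abbreviation C where "C i \<equiv> analysis ip (V i) (J i) (\<phi> i)"
abbreviation D where "D i \<equiv> synthesis smul (J i) (\<phi> i)"
abbreviation S_inv where "S_inv i \<equiv> inv_frame_op smul ip (V i) (J i) (\<phi> i)"
abbreviation C_glob where "C_glob \<equiv> analysis ip UNIV (Sigma I J) (global_frame v \<phi>)"
abbreviation D_glob where "D_glob \<equiv> synthesis smul (Sigma I J) (global_frame v \<phi>)"

text \<open>In block \<open>i\<close> the vectors lie in \<open>V i\<close> and see only the
  projection of \<open>f\<close>, so the local bound costs a factor \<open>B\<close>; summing the
  weighted projections costs \<open>B\<^sub>V\<close>.\<close>

lemma bessel_global: "bessel UNIV (Sigma I J) (global_frame v \<phi>) (B * B\<^sub>V)"
  unfolding bessel_def
proof (intro conjI ballI allI impI)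
  show "0 \<le> B * B\<^sub>V" using bounds by simp
  fix F f assume F: "finite F" "F \<subseteq> Sigma I J"
  let ?\<psi> = "global_frame v \<phi>"
  let ?F = "\<lambda>i. {j. (i, j) \<in> F}"
  let ?w = "\<lambda>i. (v i)\<^sup>2 * (norm (orth_proj ip (V i) f))\<^sup>2"
  have fin: "finite (?F i)" for i
    using finite_vimageI[OF F(1), of "Pair i"] by (simp add: vimage_def inj_on_def)
  \<comment> \<open>A finite set of pairs is split into its sections \<open>?F i\<close>, so that
    the local bound can be used on each.\<close>
  have "F = Sigma (fst ` F) ?F" by force
  then have "(\<Sum>p\<in>F. (norm (ip f (?\<psi> p)))\<^sup>2) =
      (\<Sum>i\<in>fst ` F. \<Sum>j\<in>?F i. (norm (ip f (?\<psi> (i, j))))\<^sup>2)"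
    using F(1) fin by (subst sum.Sigma) auto
  also have "\<dots> \<le> (\<Sum>i\<in>fst ` F. B * ?w i)"
  proof (rule sum_mono)
    fix i assume "i \<in> fst ` F"
    then have i: "i \<in> I" using F(2) by auto
    interpret L: local_frame smul ip "V i" "J i" "\<phi> i" A B by (rule local_frames[OF i])
    have sub: "?F i \<subseteq> J i" using F(2) by auto
    have "(norm (ip f (?\<psi> (i, j))))\<^sup>2 =
        (v i)\<^sup>2 * (norm (ip (orth_proj ip (V i) f) (\<phi> i j)))\<^sup>2" if "j \<in> ?F i" for j
    proof -
      have "\<phi> i j \<in> V i" using that sub L.bessel_K by (auto simp: bessel_def)
      then show ?thesis
        by (simp add: global_frame_def ip_scaleR_right L.ip_orth_proj power_mult_distrib)
    qed
    then have "(\<Sum>j\<in>?F i. (norm (ip f (?\<psi> (i, j))))\<^sup>2) =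
        (v i)\<^sup>2 * (\<Sum>j\<in>?F i. (norm (ip (orth_proj ip (V i) f) (\<phi> i j)))\<^sup>2)"
      by (simp add: sum_distrib_left)
    also have "\<dots> \<le> (v i)\<^sup>2 * (B * (norm (orth_proj ip (V i) f))\<^sup>2)"
      using L.bessel_K L.orth_proj_in[of f] fin sub
      by (intro mult_left_mono) (auto simp: bessel_def)
    finally show "(\<Sum>j\<in>?F i. (norm (ip f (?\<psi> (i, j))))\<^sup>2) \<le> B * ?w i"
      by (simp add: mult_ac)
  qed
  also have "\<dots> = B * (\<Sum>i\<in>fst ` F. ?w i)" by (simp add: sum_distrib_left)
  also have "\<dots> \<le> B * (\<Sum>\<^sub>\<infinity>i\<in>I. ?w i)"
    using F bounds by (intro mult_left_mono finite_sum_le_infsum fusion_summable) auto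
  also have "\<dots> \<le> B * (B\<^sub>V * (norm f)\<^sup>2)"
    using bounds fusion_upper by (intro mult_left_mono) auto
  finally show "(\<Sum>p\<in>F. (norm (ip f (?\<psi> p)))\<^sup>2) \<le> B * B\<^sub>V * (norm f)\<^sup>2"
    by (simp add: mult.assoc)
qed auto

text \<open>The squared norm of each \<open>C i \<circ> S_inv i\<close> is at most
  \<open>B / A\<^sup>2\<close>, independently of \<open>i\<close>, so square summability of
  \<open>f\<close> is inherited.\<close>

lemma direct_sum_op_dual_analysis:
  assumes f: "f \<in> hilbert_sum I V (\<lambda>_. norm)"
  shows "direct_sum_op I V (\<lambda>_. norm) (\<lambda>i. C i \<circ> S_inv i) f
    \<in> hilbert_sum I (\<lambda>i. l2 (J i)) (\<lambda>i. l2_norm (J i))" (is "?d \<in> _")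
proof -
  have d: "?d i \<in> l2 (J i) \<and> (l2_norm (J i) (?d i))\<^sup>2 \<le> B / A\<^sup>2 * (norm (f i))\<^sup>2" if i: "i \<in> I" for i
  proof -
    interpret L: local_frame smul ip "V i" "J i" "\<phi> i" A B by (rule local_frames[OF i])
    let ?x = "S_inv i (f i)"
    have fi: "f i \<in> V i" using f i by (auto simp: hilbert_sum_def)
    have di: "?d i = (\<lambda>j\<in>J i. ip ?x (\<phi> i j))"
      using f i L.inv_frame_op(1)[OF fi] by (simp add: direct_sum_op_def analysis_def)
    have "(\<lambda>j. (norm (?d i j))\<^sup>2) summable_on J i"
      using L.coefficients_summable[of ?x] by (subst summable_on_cong) (auto simp: di)
    moreover have "(l2_norm (J i) (?d i))\<^sup>2 = (\<Sum>\<^sub>\<infinity>j\<in>J i. (norm (ip ?x (\<phi> i j)))\<^sup>2)"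
      unfolding l2_norm_power2 by (intro infsum_cong) (simp add: di)
    moreover have "\<dots> \<le> B * (norm ?x)\<^sup>2"
      by (rule bessel_coefficients(2)[OF L.bessel_K])
    moreover have "\<dots> \<le> B * (norm (f i) / A)\<^sup>2"
      using bounds L.norm_inv_frame_op_le[OF fi] by (intro mult_left_mono power_mono) auto
    ultimately show ?thesis
      by (simp add: l2_def di power_divide)
  qed
  have "(\<lambda>i. B / A\<^sup>2 * (norm (f i))\<^sup>2) summable_on I"
    using f by (intro summable_on_cmult_right) (simp add: hilbert_sum_def)
  then have "(\<lambda>i. (l2_norm (J i) (?d i))\<^sup>2) summable_on I"
    by (rule summable_on_comparison_test) (use d in auto)
  moreover have "?d \<in> extensional I" using f by (simp add: direct_sum_op_def)
  ultimately show ?thesis using d by (simp add: hilbert_sum_def PiE_def)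
qed

lemma fusion_synthesis_eq:
  assumes f: "f \<in> hilbert_sum I V (\<lambda>_. norm)"
  shows "fusion_synthesis I V v f =
    D_glob (l2_join I J (direct_sum_op I V (\<lambda>_. norm) (\<lambda>i. C i \<circ> S_inv i) f))"
proof -
  let ?\<psi> = "global_frame v \<phi>"
  define d where "d = direct_sum_op I V (\<lambda>_. norm) (\<lambda>i. C i \<circ> S_inv i) f"
  have d: "d \<in> hilbert_sum I (\<lambda>i. l2 (J i)) (\<lambda>i. l2_norm (J i))"
    unfolding d_def by (rule direct_sum_op_dual_analysis[OF f])
  note c = l2_join_in_l2[OF d]
  then have sm: "(\<lambda>p. (norm (l2_join I J d p))\<^sup>2) summable_on Sigma I J"
    by (simp add: l2_def)
  \<comment> \<open>The weight leaves the block sum, and what remains is the local frame operator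
    applied to \<open>S_inv i (f i)\<close>.\<close>
  have inner: "(\<Sum>\<^sub>\<infinity>j\<in>J i. smul (l2_join I J d (i, j)) (?\<psi> (i, j))) = v i *\<^sub>R f i" if i: "i \<in> I" for i
  proof -
    interpret L: local_frame smul ip "V i" "J i" "\<phi> i" A B by (rule local_frames[OF i])
    have fi: "f i \<in> V i" using f i by (auto simp: hilbert_sum_def)
    note x = L.inv_frame_op[OF fi]
    have "l2_join I J d (i, j) = ip (S_inv i (f i)) (\<phi> i j)" if "j \<in> J i" for j
      using d f i x that by (simp add: l2_join_def d_def direct_sum_op_def analysis_def)
    then have "(\<Sum>\<^sub>\<infinity>j\<in>J i. smul (l2_join I J d (i, j)) (?\<psi> (i, j))) =
        (\<Sum>\<^sub>\<infinity>j\<in>J i. v i *\<^sub>R smul (ip (S_inv i (f i)) (\<phi> i j)) (\<phi> i j))"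
      by (intro infsum_cong) (simp add: global_frame_def scale_scaleR)
    also have "\<dots> = v i *\<^sub>R f i"
      using x by (simp add: infsum_scaleR_right L.frame_op_eq[symmetric])
    finally show ?thesis .
  qed
  have "D_glob (l2_join I J d) = (\<Sum>\<^sub>\<infinity>p\<in>Sigma I J. smul (l2_join I J d p) (?\<psi> p))"
    using c by (simp add: synthesis_def)
  \<comment> \<open>Blockwise summation requires the vector series to be summable over the whole of
    \<open>Sigma I J\<close>; the global Bessel bound ensures this.\<close>
  also have "\<dots> = (\<Sum>\<^sub>\<infinity>i\<in>I. \<Sum>\<^sub>\<infinity>j\<in>J i. smul (l2_join I J d (i, j)) (?\<psi> (i, j)))"
    by (intro infsum_Sigma_banach[symmetric] bessel_summable[OF bessel_global sm])
  also have "\<dots> = (\<Sum>\<^sub>\<infinity>i\<in>I. v i *\<^sub>R f i)"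
    by (intro infsum_cong inner)
  finally show ?thesis
    using f by (simp add: fusion_synthesis_def d_def)
qed

lemma global_coefficients:
  "l2_split I J (C_glob f) \<in> hilbert_sum I (\<lambda>i. l2 (J i)) (\<lambda>i. l2_norm (J i))"
  and dual_synthesis_global_coefficients:
    "i \<in> I \<Longrightarrow> S_inv i (D i (l2_split I J (C_glob f) i)) = v i *\<^sub>R orth_proj ip (V i) f"
proof -
  let ?x = "l2_split I J (C_glob f)"
  have "(\<lambda>p. (norm (C_glob f p))\<^sup>2) summable_on Sigma I J"
    using bessel_coefficients(1)[OF bessel_global, of f]
    by (subst summable_on_cong) (auto simp: analysis_def)
  then have c: "C_glob f \<in> l2 (Sigma I J)"
    by (simp add: l2_def analysis_def)
  then show x: "?x \<in> hilbert_sum I (\<lambda>i. l2 (J i)) (\<lambda>i. l2_norm (J i))"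
    by (rule l2_split_in_hilbert_sum)
  show "S_inv i (D i (?x i)) = v i *\<^sub>R orth_proj ip (V i) f" if i: "i \<in> I"
  proof -
    interpret L: local_frame smul ip "V i" "J i" "\<phi> i" A B by (rule local_frames[OF i])
    have "?x i \<in> l2 (J i)" using x i by (auto simp: hilbert_sum_def)
    then have "D i (?x i) = (\<Sum>\<^sub>\<infinity>j\<in>J i. smul (?x i j) (\<phi> i j))"
      by (simp add: synthesis_def)
    \<comment> \<open>The real weight moves from the frame vector to \<open>f\<close>, which turns
      the block into the local coefficients of \<open>v i *\<^sub>R f\<close>, ready for the
      projection formula.\<close>
    also have "\<dots> = (\<Sum>\<^sub>\<infinity>j\<in>J i. smul (ip (v i *\<^sub>R f) (\<phi> i j)) (\<phi> i j))"
      using c i by (intro infsum_cong)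
        (simp add: l2_split_def analysis_def global_frame_def ip_scaleR_left ip_scaleR_right)
    finally show ?thesis
      by (simp add: L.orth_proj_eq[symmetric] L.orth_proj_scaleR)
  qed
qed

text \<open>Puts the analysis of \<open>f\<close> in the domain of \<open>fusion_synthesis\<close>,
  as the factorization of the fusion frame operator requires.\<close>

lemma fusion_analysis_in_hilbert_sum: "fusion_analysis ip I V v f \<in> hilbert_sum I V (\<lambda>_. norm)"
proof -
  have "v i *\<^sub>R orth_proj ip (V i) f \<in> V i" if "i \<in> I" for i
    using local_frame.orth_proj_in[OF local_frames[OF that]]
      local_frame.subspace_K[OF local_frames[OF that]] by (intro subspace_scaleR)
  moreover have "(\<lambda>i. (norm (fusion_analysis ip I V v f i))\<^sup>2) summable_on I"
    using fusion_summable[of f]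
    by (subst summable_on_cong) (auto simp: fusion_analysis_def power_mult_distrib)
  ultimately show ?thesis
    by (auto simp: hilbert_sum_def fusion_analysis_def)
qed

lemma fusion_analysis_eq:
  "fusion_analysis ip I V v f =
    direct_sum_op I (\<lambda>i. l2 (J i)) (\<lambda>i. l2_norm (J i)) (\<lambda>i. S_inv i \<circ> D i) (l2_split I J (C_glob f))"
  using global_coefficients[of f]
  by (auto simp: fusion_analysis_def direct_sum_op_def dual_synthesis_global_coefficients)

lemma fusion_frame_op_eq:
  "fusion_frame_op ip I V v f =
    D_glob (l2_join I J (direct_sum_op I (\<lambda>i. l2 (J i)) (\<lambda>i. l2_norm (J i))
      (\<lambda>i. C i \<circ> S_inv i \<circ> S_inv i \<circ> D i) (l2_split I J (C_glob f))))"
proof -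
  let ?g = "fusion_analysis ip I V v f"
  have "fusion_frame_op ip I V v f = fusion_synthesis I V v ?g"
    using fusion_analysis_in_hilbert_sum[of f]
    by (auto simp: fusion_frame_op_def fusion_synthesis_def fusion_analysis_def power2_eq_square
        intro!: infsum_cong)
  also have "\<dots> = D_glob (l2_join I J (direct_sum_op I V (\<lambda>_. norm) (\<lambda>i. C i \<circ> S_inv i) ?g))"
    by (rule fusion_synthesis_eq[OF fusion_analysis_in_hilbert_sum])
  \<comment> \<open>Entry \<open>i\<close> of \<open>?g\<close> is already \<open>S_inv i\<close> of
    a local synthesis; composing with \<open>C i \<circ> S_inv i\<close> yields the squared
    inverse.\<close>
  also have "direct_sum_op I V (\<lambda>_. norm) (\<lambda>i. C i \<circ> S_inv i) ?g =
      direct_sum_op I (\<lambda>i. l2 (J i)) (\<lambda>i. l2_norm (J i))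
        (\<lambda>i. C i \<circ> S_inv i \<circ> S_inv i \<circ> D i) (l2_split I J (C_glob f))"
    using global_coefficients[of f] fusion_analysis_in_hilbert_sum[of f]
    by (auto simp: direct_sum_op_def dual_synthesis_global_coefficients fusion_analysis_def)
  finally show ?thesis .
qed

end

theorem proposition4p7:
  fixes smul :: "'k::rc_field \<Rightarrow> 'v::banach \<Rightarrow> 'v"
    and ip :: "'v \<Rightarrow> 'v \<Rightarrow> 'k"
    and I :: "'i set" and V :: "'i \<Rightarrow> 'v set" and v :: "'i \<Rightarrow> real"
    and J :: "'i \<Rightarrow> 'j set" and \<phi> :: "'i \<Rightarrow> 'j \<Rightarrow> 'v"
  assumes "separable_hilbert_space smul ip"
    and "fusion_frame_system smul ip I V v J \<phi>"
  defines "C \<equiv> \<lambda>i. analysis ip (V i) (J i) (\<phi> i)"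
    and "D \<equiv> \<lambda>i. synthesis smul (J i) (\<phi> i)"
    and "S_inv \<equiv> \<lambda>i. inv_frame_op smul ip (V i) (J i) (\<phi> i)"
    and "C_glob \<equiv> analysis ip UNIV (Sigma I J) (global_frame v \<phi>)"
    and "D_glob \<equiv> synthesis smul (Sigma I J) (global_frame v \<phi>)"
  shows "(\<forall>f \<in> hilbert_sum I V (\<lambda>_. norm).
            fusion_synthesis I V v f =
              (D_glob \<circ> l2_join I J \<circ> direct_sum_op I V (\<lambda>_. norm) (\<lambda>i. C i \<circ> S_inv i)) f) \<and>
         fusion_analysis ip I V v =
           direct_sum_op I (\<lambda>i. l2 (J i)) (\<lambda>i. l2_norm (J i)) (\<lambda>i. S_inv i \<circ> D i)
             \<circ> l2_split I J \<circ> C_glob \<and>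
         fusion_frame_op ip I V v =
           D_glob \<circ> l2_join I J
             \<circ> direct_sum_op I (\<lambda>i. l2 (J i)) (\<lambda>i. l2_norm (J i))
                 (\<lambda>i. C i \<circ> S_inv i \<circ> S_inv i \<circ> D i)
             \<circ> l2_split I J \<circ> C_glob"
proof -
  interpret separable_hilbert_space smul ip by (rule assms(1))
  obtain A B where AB: "0 < A" "A \<le> B"
    and frames: "\<And>i. i \<in> I \<Longrightarrow> frame_with_bounds ip (V i) (J i) (\<phi> i) A B"
    and fusion: "fusion_frame smul ip I V v"
    using assms(2) unfolding fusion_frame_system_def by blast
  obtain B\<^sub>V where "0 \<le> B\<^sub>V"
    and summ: "\<And>f. (\<lambda>i. (v i)\<^sup>2 * (norm (orth_proj ip (V i) f))\<^sup>2) summable_on I"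
    and upper: "\<And>f. (\<Sum>\<^sub>\<infinity>i\<in>I. (v i)\<^sup>2 * (norm (orth_proj ip (V i) f))\<^sup>2) \<le> B\<^sub>V * (norm f)\<^sup>2"
    using fusion unfolding fusion_frame_def by (meson less_imp_le order_trans)
  have "local_frame smul ip (V i) (J i) (\<phi> i) A B" if "i \<in> I" for i
    using that fusion frames
    by (intro local_frame.intro local_frame_axioms.intro separable_hilbert_space_axioms)
      (auto simp: fusion_frame_def)
  then interpret fusion_system smul ip I V v J \<phi> A B B\<^sub>V
    using AB \<open>0 \<le> B\<^sub>V\<close> summ upper
    by (intro fusion_system.intro fusion_system_axioms.intro separable_hilbert_space_axioms) auto
  \<comment> \<open>Since \<open>fun_eq_iff\<close> also evaluates the analysis identity at an index
    \<open>i\<close>, \<open>fusion_analysis_eq\<close> is supplied in pointwise form.\<close>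
  show ?thesis
    unfolding C_def D_def S_inv_def C_glob_def D_glob_def
    by (auto simp: fun_eq_iff fusion_synthesis_eq fusion_frame_op_eq
        fusion_analysis_eq[unfolded fun_eq_iff])
qed

end
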